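(* Fix $s\in\mathbb C\setminus\mathbb Z$ and let $(a,c)$ range over the open square $(0,1)\times(0,1)$. Write $G(s):=\dfrac{\pi^{-\frac{1-s}{2}}\Gamma(\frac{1-s}{2})}{\pi^{-\frac s2}\Gamma(\frac s2)}$. Then: (i) As $(a,c)\to(1^-,1^-)$: $\zeta_*(s,a,c)-\frac12G(s)\big(1-i\cot\frac{\pi s}{2}\big)e^{2\pi i(1-a)c}(1-a)^{s-1}\to\zeta_*(s,1,1)$. (ii) As $(a,c)\to(0^+,1^-)$: $\zeta_*(s,a,c)-\frac12G(s)\big(1+i\cot\frac{\pi s}{2}\big)e^{-2\pi i ac}a^{s-1}\to\zeta_*(s,0,1)$. (iii) As $(a,c)\to(1^-,0^+)$: $\zeta_*(s,a,c)-\Big(c^{-s}+\frac12G(s)\big(1-i\cot\frac{\pi s}{2}\big)e^{2\pi i(1-a)c}(1-a)^{s-1}\Big)\to\zeta_*(s,1,0)$. (iv) As $(a,c)\to(0^+,0^+)$: $\zeta_*(s,a,c)-\Big(c^{-s}+\frac12G(s)\big(1+i\cot\frac{\pi s}{2}\big)e^{-2\pi i ac}a^{s-1}\Big)\to\zeta_*(s,0,0)$.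
   Context: Let $\delta_{\mathbb Z}(x)=1$ if $x\in\mathbb Z$ and $0$ otherwise. For real $a,c$ and $s\in\mathbb C\setminus\{0,1\}$ define $$\Lambda^{+}(s,a,c):=2\int_1^\infty\Big(\sum_{n\in\mathbb Z,\,n\ne -c}e^{2\pi i a n}e^{-\pi(n+c)^2x^2}\Big)x^{s-1}dx+2\int_1^\infty\Big(\sum_{n\in\mathbb Z,\,n\neq a}e^{2\pi i c(n-a)}e^{-\pi(n-a)^2y^2}\Big)y^{-s}dy+\frac{2\delta_{\mathbb Z}(a)}{s-1}-\frac{2\delta_{\mathbb Z}(c)e^{-2\pi i ac}}{s},$$ $$\Lambda^{-}(s,a,c):=2\int_1^\infty\Big(\sum_{n\in\mathbb Z}e^{2\pi i a n}(n+c)e^{-\pi(n+c)^2x^2}\Big)x^{s}dx-2i\int_1^\infty\Big(\sum_{n\in\mathbb Z}e^{2\pi i c(n-a)}(n-a)e^{-\pi(n-a)^2y^2}\Big)y^{1-s}dy,$$ and the extended Lerch zeta function $\zeta_*(s,a,c):=\frac12\big(\frac{\pi^{s/2}}{\Gamma(s/2)}\Lambda^{+}(s,a,c)+\frac{\pi^{(s+1)/2}}{\Gamma(\frac{s+1}{2})}\Lambda^{-}(s,a,c)\big)$ (meromorphic in $s$). For $0<a,c<1$ it equals the Lerch zeta function $\sum_{n\ge0}e^{2\pi i n a}(n+c)^{-s}$ (analytically continued in $s$). *)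

theory Defs
  imports "HOL-Analysis.Analysis"
begin

definition delta_Z :: "real \<Rightarrow> complex" where
  "delta_Z x = (if x \<in> \<int> then 1 else 0)"

(* The series and integrals below converge absolutely for all real a, c and all complex s.
   The closed form of Lambda_plus is meaningful only for s distinct from 0 and 1,
   where its denominators do not vanish. *)

definition Lambda_plus :: "complex \<Rightarrow> real \<Rightarrow> real \<Rightarrow> complex" where
  "Lambda_plus s a c =
     2 * (LINT x:{1..}|lborel.
            (\<Sum>\<^sub>\<infinity>n\<in>{n::int. of_int n \<noteq> - c}.
               exp (2 * of_real pi * \<i> * of_real a * of_int n)
               * of_real (exp (- pi * (of_int n + c)\<^sup>2 * x\<^sup>2)))
            * of_real x powr (s - 1))
   + 2 * (LINT y:{1..}|lborel.
            (\<Sum>\<^sub>\<infinity>n\<in>{n::int. of_int n \<noteq> a}.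
               exp (2 * of_real pi * \<i> * of_real c * of_real (of_int n - a))
               * of_real (exp (- pi * (of_int n - a)\<^sup>2 * y\<^sup>2)))
            * of_real y powr (- s))
   + 2 * delta_Z a / (s - 1)
   - 2 * delta_Z c * exp (- 2 * of_real pi * \<i> * of_real a * of_real c) / s"

definition Lambda_minus :: "complex \<Rightarrow> real \<Rightarrow> real \<Rightarrow> complex" where
  "Lambda_minus s a c =
     2 * (LINT x:{1..}|lborel.
            (\<Sum>\<^sub>\<infinity>n\<in>(UNIV::int set).
               exp (2 * of_real pi * \<i> * of_real a * of_int n)
               * of_real ((of_int n + c) * exp (- pi * (of_int n + c)\<^sup>2 * x\<^sup>2)))
            * of_real x powr s)
   - 2 * \<i> * (LINT y:{1..}|lborel.
            (\<Sum>\<^sub>\<infinity>n\<in>(UNIV::int set).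
               exp (2 * of_real pi * \<i> * of_real c * of_real (of_int n - a))
               * of_real ((of_int n - a) * exp (- pi * (of_int n - a)\<^sup>2 * y\<^sup>2)))
            * of_real y powr (1 - s))"

(* At the poles of Gamma the library has Gamma z = 0, so that the quotients below
   are 0 there, in agreement with 1 / Gamma being entire with zeros at these points. *)

definition lerch_zeta_star :: "complex \<Rightarrow> real \<Rightarrow> real \<Rightarrow> complex" where
  "lerch_zeta_star s a c =
     1 / 2 * (of_real pi powr (s / 2) / Gamma (s / 2) * Lambda_plus s a c
            + of_real pi powr ((s + 1) / 2) / Gamma ((s + 1) / 2) * Lambda_minus s a c)"

definition gamma_ratio :: "complex \<Rightarrow> complex" where
  "gamma_ratio s =
     (of_real pi powr (- ((1 - s) / 2)) * Gamma ((1 - s) / 2))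
     / (of_real pi powr (- (s / 2)) * Gamma (s / 2))"

end

theory Submission imports Defs begin

text \<open>
  Each integral in \<open>\<Lambda>\<^sup>\<plusminus>\<close> is a Mellin transform over \<open>[1, \<infinity>)\<close> of a theta series in \<open>n + d\<close>, where
  \<open>d = c\<close> or \<open>d = -a\<close>. As \<open>d\<close> tends to an integer \<open>m\<close>, all terms but \<open>n = -m\<close> stay away from \<open>0\<close>
  and pass to the limit by dominated convergence. The exceptional term is
  \<open>\<integral>\<^sub>1\<^sup>\<infinity> exp (-\<pi>u\<^sup>2x\<^sup>2) x\<^bsup>w-1\<^esup> dx\<close> with \<open>u = |d - m|\<close>. Subtracting the singular part
  \<open>\<pi>\<^bsup>-w/2\<^esup> \<Gamma>(w/2) u\<^bsup>-w\<^esup> / 2\<close> leaves \<open>-\<integral>\<^sub>0\<^sup>1\<close> for \<open>Re w > 0\<close>, and an integration by parts that shifts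
  \<open>w\<close> by \<open>2\<close> shows that for every \<open>w\<close> the difference tends to \<open>-1/w\<close>. These limits are the polar
  terms of \<open>\<Lambda>\<^sup>+\<close> at the corner, while the reflection formula turns the singular parts of \<open>\<Lambda>\<^sup>+\<close> and
  \<open>\<Lambda>\<^sup>-\<close> into \<open>c\<^bsup>-s\<^esup>\<close> (cancelling at \<open>c = 1\<close>) and \<open>G(s) (1 \<plusminus> i cot (\<pi>s/2)) / 2\<close> times a power.
\<close>

section \<open>The truncated Mellin transform of a Gaussian\<close>

text \<open>For \<open>u > 0\<close> this is half of (pi u^2)^(-w/2) times the upper incomplete
  Gamma function at (w/2, pi u^2). Cutting at 1 makes it converge for every
  \<open>w\<close>.\<close>

definition gauss_mellin :: "complex \<Rightarrow> real \<Rightarrow> complex" where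
  "gauss_mellin w u = (LINT x:{1..}|lborel. of_real (exp (- pi * u\<^sup>2 * x\<^sup>2)) * of_real x powr (w - 1))"

text \<open>The Mellin transform of the Gaussian over the whole half-line \<open>(0, \<infinity>)\<close>, continued in \<open>w\<close>.\<close>

definition gauss_sing :: "complex \<Rightarrow> real \<Rightarrow> complex" where
  "gauss_sing w u = 1 / 2 * of_real pi powr (- (w / 2)) * Gamma (w / 2) * of_real u powr (- w)"

section \<open>Integrability of the Gaussian against powers\<close>

lemma set_borel_measurable_lborel_continuous_on:
  fixes f :: "real \<Rightarrow> 'a::real_normed_vector"
  assumes "A \<in> sets borel" "continuous_on A f"
  shows "set_borel_measurable lborel A f"
  using borel_measurable_continuous_on_indicator[OF assms]
  by (simp add: set_borel_measurable_def)

lemma set_integrable_exp_powr: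
  fixes \<alpha> p :: real
  assumes "\<alpha> > 0"
  shows "set_integrable lborel {1..} (\<lambda>x. exp (- \<alpha> * x) * x powr p)"
proof -
  \<comment> \<open>The Gamma integrand with this positive exponent is the majorant, since
    \<open>x powr p \<le> x powr \<bar>p\<bar>\<close> for x \<ge> 1.\<close>
  define z where "z = complex_of_real (\<bar>p\<bar> + 1)"
  have "(\<lambda>t. complex_of_real t powr (z - 1) / of_real (exp (\<alpha> * t))) absolutely_integrable_on {0<..}"
    by (rule absolutely_integrable_Gamma_integral) (use assms in \<open>auto simp: z_def\<close>)
  hence "(\<lambda>t. complex_of_real t powr (z - 1) / of_real (exp (\<alpha> * t))) absolutely_integrable_on {1..}"
    by (rule set_integrable_subset) auto
  moreover have "set_borel_measurable lborel {1..} (\<lambda>t. complex_of_real t powr (z - 1) / of_real (exp (\<alpha> * t)))"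
    by (intro set_borel_measurable_lborel_continuous_on continuous_intros) auto
  \<comment> \<open>\<open>absolutely_integrable_on\<close> refers to the completed measure; Borel
    measurability of the integrand brings the statement down to \<open>lborel\<close>.\<close>
  ultimately have 1: "set_integrable lborel {1..} (\<lambda>t. complex_of_real t powr (z - 1) / of_real (exp (\<alpha> * t)))"
    unfolding set_integrable_def set_borel_measurable_def using integrable_completion by blast
  show ?thesis
  proof (rule set_integrable_bound[OF 1])
    show "set_borel_measurable lborel {1..} (\<lambda>x. exp (- \<alpha> * x) * x powr p)"
      by (intro set_borel_measurable_lborel_continuous_on continuous_intros) auto
    show "AE x in lborel. x \<in> {1..} \<longrightarrow> norm (exp (- \<alpha> * x) * x powr p)
       \<le> norm (complex_of_real x powr (z - 1) / of_real (exp (\<alpha> * x)))"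
    proof (intro AE_I2 impI)
      fix x :: real assume x: "x \<in> {1..}"
      have "norm (complex_of_real x powr (z - 1)) = x powr \<bar>p\<bar>"
        using x by (simp add: norm_powr_real_powr z_def)
      moreover have "x powr p \<le> x powr \<bar>p\<bar>" using x by (intro powr_mono) auto
      ultimately show "norm (exp (- \<alpha> * x) * x powr p)
       \<le> norm (complex_of_real x powr (z - 1) / of_real (exp (\<alpha> * x)))"
        by (simp add: norm_divide exp_minus field_simps)
    qed
  qed
qed

lemma set_integrable_gauss:
  assumes "u > 0"
  shows "set_integrable lborel {1..} (\<lambda>x. of_real (exp (- pi * u\<^sup>2 * x\<^sup>2)) * of_real x powr (w - 1 :: complex))"
proof (rule set_integrable_bound[OF set_integrable_exp_powr[of "pi * u\<^sup>2" "Re (w - 1)"]])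
  show "pi * u\<^sup>2 > 0" using assms by simp
  show "set_borel_measurable lborel {1..} (\<lambda>x. of_real (exp (- pi * u\<^sup>2 * x\<^sup>2)) * of_real x powr (w - 1 :: complex))"
    by (intro set_borel_measurable_lborel_continuous_on continuous_intros) auto
  show "AE x in lborel. x \<in> {1..} \<longrightarrow> norm (of_real (exp (- pi * u\<^sup>2 * x\<^sup>2)) * of_real x powr (w - 1 :: complex))
          \<le> norm (exp (- (pi * u\<^sup>2) * x) * x powr Re (w - 1))"
  proof (intro AE_I2 impI)
    fix x :: real assume x: "x \<in> {1..}"
    \<comment> \<open>On [1, \<infinity>) the inequality x \<le> x^2 lets an exponential dominate
      the Gaussian.\<close>
    have "x * 1 \<le> x\<^sup>2" using x unfolding power2_eq_square by (intro mult_left_mono) auto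
    hence "pi * u\<^sup>2 * x \<le> pi * u\<^sup>2 * x\<^sup>2" by (intro mult_left_mono) auto
    thus "norm (of_real (exp (- pi * u\<^sup>2 * x\<^sup>2)) * of_real x powr (w - 1 :: complex))
          \<le> norm (exp (- (pi * u\<^sup>2) * x) * x powr Re (w - 1))"
      using x by (simp add: norm_mult norm_powr_real_powr)
  qed
qed

text \<open>Asking for Re w \<ge> 1 makes the integrand bounded near 0, with a bound independent of
  \<open>u\<close>; smaller real parts are reached later by shifting \<open>w\<close>.\<close>

lemma norm_gauss_le_one:
  assumes "Re w \<ge> 1" "x \<in> {0<..<1}"
  shows "norm (of_real (exp (- pi * u\<^sup>2 * x\<^sup>2)) * of_real x powr (w - 1 :: complex)) \<le> 1"
proof -
  have "x powr (Re w - 1) \<le> 1" using assms by (intro powr_le1) auto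
  thus ?thesis using assms by (simp add: norm_mult norm_powr_real_powr mult_le_one)
qed

lemma set_integrable_gauss_unit:
  assumes "Re w \<ge> 1"
  shows "set_integrable lborel {0<..<1} (\<lambda>x. of_real (exp (- pi * u\<^sup>2 * x\<^sup>2)) * of_real x powr (w - 1 :: complex))"
proof (rule set_integrable_bound[of _ _ "\<lambda>_. 1::real"])
  show "set_integrable lborel {0<..<1::real} (\<lambda>_. 1::real)" by (simp add: set_integrable_def)
  show "set_borel_measurable lborel {0<..<1} (\<lambda>x. of_real (exp (- pi * u\<^sup>2 * x\<^sup>2)) * of_real x powr (w - 1 :: complex))"
    by (intro set_borel_measurable_lborel_continuous_on continuous_intros) auto
  show "AE x in lborel. x \<in> {0<..<1} \<longrightarrow> norm (of_real (exp (- pi * u\<^sup>2 * x\<^sup>2)) * of_real x powr (w - 1 :: complex))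
          \<le> norm (1::real)"
    using norm_gauss_le_one[OF assms] by auto
qed

text \<open>The substitution t = pi u^2 x^2 turns Euler's integral for Gamma(w/2) into the Mellin
  transform of the Gaussian.\<close>

lemma gauss_mellin_full:
  assumes "Re w \<ge> 1" "u > 0"
  shows "set_integrable lborel {0<..} (\<lambda>x. of_real (exp (- pi * u\<^sup>2 * x\<^sup>2)) * of_real x powr (w - 1 :: complex))" (is ?I)
    and "(LINT x:{0<..}|lborel. of_real (exp (- pi * u\<^sup>2 * x\<^sup>2)) * of_real x powr (w - 1)) = gauss_sing w u" (is ?E)
proof -
  have eq: "{0<..} = {0<..<1} \<union> {1::real..}" by auto
  show I: ?I unfolding eq
    by (intro set_integrable_Un set_integrable_gauss set_integrable_gauss_unit assms) auto
  define f where "f = (\<lambda>t. complex_of_real t powr (w / 2 - 1) / of_real (exp t))"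
  define g where "g = (\<lambda>x. pi * u\<^sup>2 * x\<^sup>2)"
  define g' where "g' = (\<lambda>x. pi * u\<^sup>2 * (2 * x))"
  \<comment> \<open>The constant pulled out by the substitution: the Jacobian 2 pi u^2 x times (pi
    u^2 x^2)^(w/2 - 1) equals K x^(w-1).\<close>
  define K where "K = 2 * of_real (pi * u\<^sup>2) powr (w / 2)"
  have Re: "Re (w / 2) > 0" using assms by simp
  have einf: "einterval 0 \<infinity> = {0<..}" by (auto simp: einterval_def zero_ereal_def)
  have fg: "g' x *\<^sub>R f (g x) = K * (of_real (exp (- pi * u\<^sup>2 * x\<^sup>2)) * of_real x powr (w - 1))"
    if x: "x > 0" for x
  proof -
    have "complex_of_real (g x) powr (w / 2 - 1) = of_real (pi * u\<^sup>2) powr (w / 2 - 1) * of_real (x\<^sup>2) powr (w / 2 - 1)"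
      unfolding g_def of_real_mult[of "pi * u\<^sup>2"] using x assms by (intro powr_times_real) auto
    also have "of_real (x\<^sup>2) powr (w / 2 - 1) = (of_real x powr (w - 2) :: complex)"
      using x by (simp add: powr_def Ln_of_real ln_realpow algebra_simps flip: of_real_power)
    also have "complex_of_real (pi * u\<^sup>2) powr (w / 2 - 1) = of_real (pi * u\<^sup>2) powr (w / 2) / of_real (pi * u\<^sup>2)"
      using assms by (simp add: powr_diff)
    also have "of_real x powr (w - 2) = of_real x powr (w - 1) / complex_of_real x"
      using x powr_diff[of "of_real x" "w - 1" 1] by (simp add: algebra_simps)
    finally show ?thesis
      using x assms by (simp add: f_def K_def g'_def g_def scaleR_conv_of_real exp_minus field_simps)
  qed
  have fint: "set_integrable lborel {0<..} f"
  proof -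
    have "f absolutely_integrable_on {0<..}"
      unfolding f_def by (rule absolutely_integrable_Gamma_integral'[OF Re])
    moreover have "set_borel_measurable lborel {0<..} f"
      unfolding f_def by (intro set_borel_measurable_lborel_continuous_on continuous_intros) auto
    ultimately show ?thesis
      unfolding set_integrable_def set_borel_measurable_def using integrable_completion by blast
  qed
  have "(LBINT x=0..\<infinity>. f x) = (LBINT x=0..\<infinity>. g' x *\<^sub>R f (g x))"
  proof (rule interval_integral_substitution_integrable)
    show "DERIV g x :> g' x" for x unfolding g_def g'_def by (auto intro!: derivative_eq_intros)
    show "isCont f (g x)" if "0 < ereal x" for x
      unfolding f_def using that assms
      by (intro continuous_intros) (auto simp: g_def zero_ereal_def complex_nonpos_Reals_iff)
    show "isCont g' x" for x unfolding g'_def by (intro continuous_intros)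
    show "0 \<le> g' x" if "0 \<le> ereal x" for x using that by (auto simp: g'_def zero_ereal_def)
    \<comment> \<open>Endpoints: \<open>g\<close> tends to 0 at 0 and to infinity at infinity, so
      the half-line is mapped onto itself.\<close>
    have "(g \<longlongrightarrow> g 0) (at_right 0)" unfolding g_def by (intro tendsto_intros)
    hence "((ereal \<circ> g) \<longlongrightarrow> 0) (at_right 0)"
      by (auto simp: g_def o_def zero_ereal_def intro!: tendsto_intros)
    thus "((ereal \<circ> g \<circ> real_of_ereal) \<longlongrightarrow> 0) (at_right 0)"
      by (simp add: zero_ereal_def ereal_tendsto_simps1(2) o_assoc)
    have "filterlim g at_top at_top"
      unfolding g_def using assms
      by (intro filterlim_tendsto_pos_mult_at_top[OF tendsto_const] filterlim_pow_at_top filterlim_ident) auto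
    hence "((ereal \<circ> g) \<longlongrightarrow> \<infinity>) at_top"
      by (simp add: o_def tendsto_PInfty_eq_at_top)
    thus "((ereal \<circ> g \<circ> real_of_ereal) \<longlongrightarrow> \<infinity>) (at_left \<infinity>)"
      by (simp add: ereal_tendsto_simps1)
    have "set_integrable lborel {0<..} (\<lambda>x. K * (of_real (exp (- pi * u\<^sup>2 * x\<^sup>2)) * of_real x powr (w - 1)))"
      using I by simp
    thus "set_integrable lborel (einterval 0 \<infinity>) (\<lambda>x. g' x *\<^sub>R f (g x))"
      unfolding einf by (rule set_integrable_cong[THEN iffD1, rotated -1]) (auto simp: fg)
    show "set_integrable lborel (einterval 0 \<infinity>) f" using fint unfolding einf .
  qed auto
  also have "(LBINT x=0..\<infinity>. g' x *\<^sub>R f (g x)) = (LINT x:{0<..}|lborel. g' x *\<^sub>R f (g x))"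
    by (simp add: interval_lebesgue_integral_def einf)
  also have "\<dots> = (LINT x:{0<..}|lborel. K * (of_real (exp (- pi * u\<^sup>2 * x\<^sup>2)) * of_real x powr (w - 1)))"
    by (rule set_lebesgue_integral_cong) (auto simp: fg)
  also have "\<dots> = K * (LINT x:{0<..}|lborel. of_real (exp (- pi * u\<^sup>2 * x\<^sup>2)) * of_real x powr (w - 1))"
    by simp
  also have "(LBINT x=0..\<infinity>. f x) = (LINT x:{0<..}|lborel. f x)"
    by (simp add: interval_lebesgue_integral_def einf)
  also have "\<dots> = integral {0<..} f"
    by (rule set_borel_integral_eq_integral(2)[OF fint])
  also have "\<dots> = Gamma (w / 2)"
    unfolding f_def using Gamma_integral_complex'[OF Re] by (rule integral_unique)
  finally have G: "Gamma (w / 2) = K * (LINT x:{0<..}|lborel. of_real (exp (- pi * u\<^sup>2 * x\<^sup>2)) * of_real x powr (w - 1))" .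
  have "K = 2 * of_real pi powr (w / 2) * of_real (u\<^sup>2) powr (w / 2)"
    unfolding K_def of_real_mult using assms by (subst powr_times_real) auto
  also have "of_real (u\<^sup>2) powr (w / 2) = (of_real u powr w :: complex)"
    using assms by (simp add: powr_def Ln_of_real ln_realpow algebra_simps flip: of_real_power)
  finally have K: "K = 2 * of_real pi powr (w / 2) * of_real u powr w" .
  have "K \<noteq> 0" using assms by (simp add: K)
  have "gauss_sing w u = Gamma (w / 2) / K"
    using assms by (simp add: gauss_sing_def K powr_minus field_simps)
  also have "\<dots> = (LINT x:{0<..}|lborel. of_real (exp (- pi * u\<^sup>2 * x\<^sup>2)) * of_real x powr (w - 1))"
    using \<open>K \<noteq> 0\<close> unfolding G by simp
  finally show ?E ..
qed

text \<open>The two functions differ by the integral over (0, 1), whose integrand has modulus at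
  most 1 whatever \<open>u\<close> is.\<close>

lemma gauss_mellin_diff_bound:
  assumes "Re w \<ge> 1" "u > 0"
  shows "norm (gauss_mellin w u - gauss_sing w u) \<le> 1"
proof -
  let ?f = "\<lambda>x. of_real (exp (- pi * u\<^sup>2 * x\<^sup>2)) * of_real x powr (w - 1 :: complex)"
  have eq: "{0<..} = {0<..<1} \<union> {1::real..}" by auto
  have "gauss_sing w u = (LINT x:{0<..<1}|lborel. ?f x) + gauss_mellin w u"
    unfolding gauss_mellin_full(2)[OF assms, symmetric] eq gauss_mellin_def
    by (intro set_integral_Un set_integrable_gauss set_integrable_gauss_unit assms) auto
  hence "norm (gauss_mellin w u - gauss_sing w u) = norm (LINT x:{0<..<1}|lborel. ?f x)"
    by simp
  also have "\<dots> \<le> (LINT x:{0<..<1::real}|lborel. (1::real))"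
    unfolding set_lebesgue_integral_def
  proof (rule Bochner_Integration.integral_norm_bound_integral)
    show "integrable lborel (\<lambda>x. indicator {0<..<1} x *\<^sub>R ?f x)"
      using set_integrable_gauss_unit[OF assms(1)] unfolding set_integrable_def .
    show "integrable lborel (\<lambda>x::real. indicator {0<..<1} x *\<^sub>R (1::real))" by simp
  qed (use norm_gauss_le_one[OF assms(1)] in \<open>auto simp: indicator_def\<close>)
  also have "\<dots> = 1" by (simp add: set_lebesgue_integral_def)
  finally show ?thesis .
qed

section \<open>The recursion from w to w + 2 and the limit at u = 0\<close>

lemma gauss_mellin_by_parts:
  assumes "w \<noteq> 0" "u > 0"
  shows "gauss_mellin w u = - of_real (exp (- pi * u\<^sup>2)) / w + 2 * of_real (pi * u\<^sup>2) / w * gauss_mellin (w + 2) u"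
proof -
  let ?f = "\<lambda>x. of_real (exp (- pi * u\<^sup>2 * x\<^sup>2)) * of_real x powr (w - 1 :: complex)"
  let ?h = "\<lambda>x. of_real (exp (- pi * u\<^sup>2 * x\<^sup>2)) * of_real x powr (w + 2 - 1 :: complex)"
  define C where "C = 2 * complex_of_real (pi * u\<^sup>2)"
  \<comment> \<open>The derivative of \<open>F\<close> has two parts, which integrate to the
    transforms at w and at w + 2. The value of \<open>F\<close> at 1 gives the exponential term; at
    infinity \<open>F\<close> vanishes.\<close>
  define F where "F = (\<lambda>x. of_real (exp (- pi * u\<^sup>2 * x\<^sup>2)) * complex_of_real x powr w)"
  have einf: "einterval 1 \<infinity> = {1<..}" by (auto simp: einterval_def one_ereal_def)
  have I: "set_integrable lborel {1<..} ?f" "set_integrable lborel {1<..} ?h"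
    by (rule set_integrable_subset[OF set_integrable_gauss[OF assms(2)]]; auto)+
  have shift: "(LINT x:{1..}|lborel. \<phi> x) = (LINT x:{1<..}|lborel. \<phi> x)" for \<phi> :: "real \<Rightarrow> complex"
    by (rule set_integral_discrete_difference[of "{1}"]) auto
  have E: "gauss_mellin w u = (LINT x:{1<..}|lborel. ?f x)" 
          "gauss_mellin (w + 2) u = (LINT x:{1<..}|lborel. ?h x)"
    unfolding gauss_mellin_def
    by (rule shift)+
  have "(LBINT x=1..\<infinity>. w * ?f x - C * ?h x) = 0 - of_real (exp (- pi * u\<^sup>2))"
  proof (rule interval_integral_FTC_integrable)
    fix x :: real assume "1 < ereal x"
    hence x: "x > 1" by (simp add: one_ereal_def)
    have p: "complex_of_real x powr (1 + w) = of_real x powr w * of_real x"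
      using x by (simp add: powr_add)
    have xn: "complex_of_real x \<notin> \<real>\<^sub>\<le>\<^sub>0" using x by (auto simp: complex_nonpos_Reals_iff)
    \<comment> \<open>The derivative is taken in the complex plane, off the nonpositive reals, and
      then restricted to the real line.\<close>
    have "((\<lambda>z. exp (- of_real pi * (of_real u)\<^sup>2 * z\<^sup>2)) has_field_derivative
            - (C * of_real x * of_real (exp (- pi * u\<^sup>2 * x\<^sup>2)))) (at (complex_of_real x))"
      by (auto intro!: derivative_eq_intros simp: C_def exp_of_real[symmetric])
    from DERIV_mult[OF this has_field_derivative_powr[OF xn, of w]]
    have "((\<lambda>z. exp (- of_real pi * (of_real u)\<^sup>2 * z\<^sup>2) * z powr w) has_field_derivative
            (w * ?f x - C * ?h x)) (at (complex_of_real x))"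
      by (simp add: p algebra_simps exp_of_real[symmetric])
    hence "((\<lambda>x. exp (- of_real pi * (of_real u)\<^sup>2 * (complex_of_real x)\<^sup>2) * complex_of_real x powr w) has_vector_derivative
            (w * ?f x - C * ?h x)) (at x)"
      by (rule has_vector_derivative_real_field)
    thus "(F has_vector_derivative (w * ?f x - C * ?h x)) (at x)"
      by (simp add: F_def exp_of_real[symmetric])
    show "isCont (\<lambda>x. w * ?f x - C * ?h x) x"
      using xn by (intro continuous_intros) auto
  next
    show "set_integrable lborel (einterval 1 \<infinity>) (\<lambda>x. w * ?f x - C * ?h x)"
      unfolding einf using I by (intro set_integral_diff set_integrable_mult_right)
    have "isCont F 1" unfolding F_def by (intro continuous_intros) auto
    hence "(F \<longlongrightarrow> F 1) (at_right 1)" by (meson isCont_def tendsto_within_subset subset_UNIV)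
    thus "((F \<circ> real_of_ereal) \<longlongrightarrow> of_real (exp (- pi * u\<^sup>2))) (at_right 1)"
      by (simp add: one_ereal_def ereal_tendsto_simps1 F_def)
    \<comment> \<open>The function equals exp(-x (pi u^2 x - Re w ln x / x)), and the inner bracket
      tends to infinity because ln x / x tends to 0.\<close>
    have "((\<lambda>x. exp (- pi * u\<^sup>2 * x\<^sup>2) * x powr Re w) \<longlongrightarrow> 0) at_top"
    proof -
      have "((\<lambda>x. - (Re w * (ln x / x))) \<longlongrightarrow> - (Re w * 0)) at_top"
        by (intro tendsto_intros ln_x_over_x_tendsto_0)
      moreover have "filterlim (\<lambda>x. (pi * u\<^sup>2) * x) at_top at_top"
        using assms by (intro filterlim_tendsto_pos_mult_at_top[OF tendsto_const] filterlim_ident) auto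
      ultimately have "filterlim (\<lambda>x. x * (- (Re w * (ln x / x)) + pi * u\<^sup>2 * x)) at_top at_top"
        by (intro filterlim_at_top_mult_at_top[OF filterlim_ident] filterlim_tendsto_add_at_top)
      hence "((\<lambda>x. exp (- (x * (- (Re w * (ln x / x)) + pi * u\<^sup>2 * x)))) \<longlongrightarrow> 0) at_top"
        by (intro filterlim_compose[OF exp_at_bot]) (simp add: filterlim_uminus_at_bot)
      thus ?thesis
      proof (rule Lim_transform_eventually)
        show "\<forall>\<^sub>F x in at_top. exp (- (x * (- (Re w * (ln x / x)) + pi * u\<^sup>2 * x))) = exp (- pi * u\<^sup>2 * x\<^sup>2) * x powr Re w"
          using eventually_gt_at_top[of 0]
          by eventually_elim (simp add: powr_def algebra_simps power2_eq_square flip: exp_add)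
      qed
    qed
    hence "((\<lambda>x. norm (F x)) \<longlongrightarrow> 0) at_top"
      by (rule Lim_transform_eventually)
         (rule eventually_mono[OF eventually_gt_at_top[of 0]], simp add: F_def norm_mult norm_powr_real_powr)
    hence "(F \<longlongrightarrow> 0) at_top" by (rule tendsto_norm_zero_cancel)
    thus "((F \<circ> real_of_ereal) \<longlongrightarrow> 0) (at_left \<infinity>)"
      by (simp add: ereal_tendsto_simps1)
  qed (auto simp: one_ereal_def)
  also have "(LBINT x=1..\<infinity>. w * ?f x - C * ?h x) = (LINT x:{1<..}|lborel. w * ?f x - C * ?h x)"
    by (simp add: interval_lebesgue_integral_def einf one_ereal_def)
  also have "\<dots> = w * gauss_mellin w u - C * gauss_mellin (w + 2) u"
    using I unfolding E by (subst set_integral_diff) auto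
  finally show ?thesis using assms by (simp add: C_def field_simps)
qed


text \<open>By the functional equation of Gamma this is the recursion of
  \<open>gauss_mellin_by_parts\<close> without the boundary term. Hence the difference of the two
  functions obeys that recursion too, boundary term included.\<close>

lemma gauss_sing_shift:
  assumes "\<And>n. w \<noteq> - of_nat n" "u > 0"
  shows "gauss_sing w u = 2 * of_real (pi * u\<^sup>2) / w * gauss_sing (w + 2) u"
proof -
  have w0: "w \<noteq> 0" using assms(1)[of 0] by simp
  have "w / 2 \<notin> \<int>\<^sub>\<le>\<^sub>0"
  proof
    assume "w / 2 \<in> \<int>\<^sub>\<le>\<^sub>0"
    then obtain n where "w / 2 = - of_nat n" by (elim nonpos_Ints_cases')
    thus False using assms(1)[of "2 * n"] by (simp add: field_simps)
  qed
  hence G: "Gamma ((w + 2) / 2) = w / 2 * Gamma (w / 2)"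
    using Gamma_plus1[of "w / 2"] by (simp add: add_divide_distrib)
  have "of_real pi powr (- (w / 2)) = of_real pi * (of_real pi powr (- ((w + 2) / 2)) :: complex)"
    by (simp add: add_divide_distrib powr_add powr_diff)
  moreover have "of_real u powr (- w) = (of_real u)\<^sup>2 * (of_real u powr (- (w + 2)) :: complex)"
    using assms by (simp add: powr_diff)
  ultimately show ?thesis
    using assms w0 G by (simp add: gauss_sing_def field_simps)
qed

text \<open>Each use of the recursion replaces w by w + 2 at the cost of a bounded boundary term, so
  finitely many uses reach Re w \<ge> 1. The range u \<le> 1 keeps the factor u^2 bounded.\<close>

lemma gauss_mellin_diff_bounded:
  assumes "\<And>n. w \<noteq> - of_nat n"
  shows "\<exists>C. \<forall>u\<in>{0<..1}. norm (gauss_mellin w u - gauss_sing w u) \<le> C"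
proof -
  have "\<exists>C. \<forall>u\<in>{0<..1}. norm (gauss_mellin w u - gauss_sing w u) \<le> C"
    if "Re w \<ge> 1 - 2 * real k" "\<And>n. w \<noteq> - of_nat n" for k w
    using that
  proof (induction k arbitrary: w)
    case 0
    thus ?case using gauss_mellin_diff_bound by (intro exI[of _ 1]) auto
  next
    case (Suc k)
    have w0: "w \<noteq> 0" using Suc.prems(2)[of 0] by simp
    have "w + 2 \<noteq> - of_nat n" for n
      using Suc.prems(2)[of "n + 2"] by (auto simp: algebra_simps eq_neg_iff_add_eq_0)
    moreover have "Re (w + 2) \<ge> 1 - 2 * real k" using Suc.prems(1) by simp
    ultimately obtain C where C: "\<And>u. u \<in> {0<..1} \<Longrightarrow> norm (gauss_mellin (w + 2) u - gauss_sing (w + 2) u) \<le> C"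
      using Suc.IH[of "w + 2"] by blast
    show ?case
    proof (intro exI ballI)
      fix u :: real assume u: "u \<in> {0<..1}"
      have "gauss_mellin w u - gauss_sing w u = - of_real (exp (- pi * u\<^sup>2)) / w
         + 2 * of_real (pi * u\<^sup>2) / w * (gauss_mellin (w + 2) u - gauss_sing (w + 2) u)"
        using gauss_mellin_by_parts[OF w0, of u] gauss_sing_shift[OF Suc.prems(2), of u] u
        by (simp add: algebra_simps diff_divide_distrib)
      also have "norm \<dots> \<le> 1 / norm w + 2 * pi / norm w * C"
      proof (rule order.trans[OF norm_triangle_ineq add_mono])
        show "norm (- complex_of_real (exp (- pi * u\<^sup>2)) / w) \<le> 1 / norm w"
          by (simp add: norm_divide divide_right_mono)
        have "u\<^sup>2 \<le> 1" using u by (simp add: power_le_one)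
        hence "norm (2 * complex_of_real (pi * u\<^sup>2) / w) \<le> 2 * pi / norm w"
          by (auto simp: norm_divide norm_mult norm_power intro!: divide_right_mono)
        thus "norm (2 * complex_of_real (pi * u\<^sup>2) / w * (gauss_mellin (w + 2) u - gauss_sing (w + 2) u))
          \<le> 2 * pi / norm w * C"
          unfolding norm_mult[of "2 * complex_of_real (pi * u\<^sup>2) / w"]
          using C[OF u] by (intro mult_mono) auto
      qed
      finally show "norm (gauss_mellin w u - gauss_sing w u) \<le> 1 / norm w + 2 * pi / norm w * C" .
    qed
  qed
  moreover obtain k where "real k \<ge> (1 - Re w) / 2" using real_arch_simple by blast
  hence "Re w \<ge> 1 - 2 * real k" by simp
  ultimately show ?thesis using assms by blast
qed

text \<open>One more use of the recursion: its factor u^2 kills the bounded difference at w + 2 and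
  leaves the boundary term -exp(-pi u^2)/w.\<close>

lemma tendsto_gauss_mellin_diff:
  assumes "\<And>n. w \<noteq> - of_nat n"
  shows "((\<lambda>u. gauss_mellin w u - gauss_sing w u) \<longlongrightarrow> - 1 / w) (at_right 0)"
proof -
  have w0: "w \<noteq> 0" using assms[of 0] by simp
  have "w + 2 \<noteq> - of_nat n" for n
    using assms[of "n + 2"] by (auto simp: algebra_simps eq_neg_iff_add_eq_0)
  then obtain C where C: "\<And>u. u \<in> {0<..1} \<Longrightarrow> norm (gauss_mellin (w + 2) u - gauss_sing (w + 2) u) \<le> C"
    using gauss_mellin_diff_bounded by blast
  have ev: "\<forall>\<^sub>F u::real in at_right 0. u \<in> {0<..1}"
    unfolding eventually_at_right_field by (rule exI[of _ 1]) auto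
  have "((\<lambda>u. - of_real (exp (- pi * u\<^sup>2)) / w
         + 2 * of_real pi / w * (of_real (u\<^sup>2) * (gauss_mellin (w + 2) u - gauss_sing (w + 2) u)))
         \<longlongrightarrow> - of_real (exp (- pi * 0\<^sup>2)) / w + 2 * of_real pi / w * 0) (at_right 0)"
  proof (intro tendsto_intros w0)
    have "((\<lambda>u::real. u\<^sup>2 * C) \<longlongrightarrow> 0\<^sup>2 * C) (at_right 0)" by (intro tendsto_intros)
    hence "((\<lambda>u::real. u\<^sup>2 * C) \<longlongrightarrow> 0) (at_right 0)" by simp
    moreover have "\<forall>\<^sub>F u in at_right 0. norm (complex_of_real (u\<^sup>2) * (gauss_mellin (w + 2) u - gauss_sing (w + 2) u)) \<le> u\<^sup>2 * C"
      using ev by eventually_elim (use C in \<open>auto simp: norm_mult norm_power intro!: mult_left_mono\<close>)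
    ultimately show "((\<lambda>u. complex_of_real (u\<^sup>2) * (gauss_mellin (w + 2) u - gauss_sing (w + 2) u)) \<longlongrightarrow> 0) (at_right 0)"
      by (rule Lim_null_comparison[rotated])
  qed
  hence "((\<lambda>u. - of_real (exp (- pi * u\<^sup>2)) / w
         + 2 * of_real pi / w * (of_real (u\<^sup>2) * (gauss_mellin (w + 2) u - gauss_sing (w + 2) u)))
         \<longlongrightarrow> - 1 / w) (at_right 0)" by simp
  thus ?thesis
  proof (rule Lim_transform_eventually)
    show "\<forall>\<^sub>F u in at_right 0. - of_real (exp (- pi * u\<^sup>2)) / w
         + 2 * of_real pi / w * (of_real (u\<^sup>2) * (gauss_mellin (w + 2) u - gauss_sing (w + 2) u))
         = gauss_mellin w u - gauss_sing w u"
      using ev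
      by eventually_elim (use gauss_mellin_by_parts[OF w0] gauss_sing_shift[OF assms] in \<open>simp add: algebra_simps diff_divide_distrib\<close>)
  qed
qed


section \<open>Mellin transforms of theta series\<close>

lemma summable_on_exp_minus_abs_int:
  fixes \<alpha> :: real and m :: int
  assumes "\<alpha> > 0"
  shows "(\<lambda>n. exp (- \<alpha> * \<bar>of_int (n + m)\<bar>)) summable_on (UNIV :: int set)"
proof -
  let ?g = "\<lambda>n::int. exp (- \<alpha> * \<bar>of_int n\<bar>)"
  have "summable (\<lambda>k. exp (- \<alpha>) ^ k)" using assms by (intro summable_geometric) auto
  hence nat: "(\<lambda>k::nat. exp (- \<alpha> * real k)) summable_on UNIV"
    by (intro summable_nonneg_imp_summable_on) (simp_all add: exp_of_nat_mult[symmetric] mult.commute)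
  have "?g summable_on (int ` UNIV)"
    by (subst summable_on_reindex) (use nat in \<open>auto simp: o_def\<close>)
  moreover have "?g summable_on ((\<lambda>k. - int k) ` UNIV)"
    by (subst summable_on_reindex) (use nat in \<open>auto simp: o_def inj_def\<close>)
  \<comment> \<open>The index 0 lies in both images and must be kept only once.\<close>
  hence "?g summable_on ((\<lambda>k. - int k) ` UNIV - int ` UNIV)"
    by (rule summable_on_subset_banach) auto
  ultimately have "?g summable_on (int ` UNIV \<union> ((\<lambda>k. - int k) ` UNIV - int ` UNIV))"
    by (rule summable_on_Un_disjoint) auto
  also have "int ` UNIV \<union> ((\<lambda>k. - int k) ` UNIV - int ` UNIV) = UNIV"
  proof -
    have "n \<in> int ` UNIV \<union> (\<lambda>k. - int k) ` UNIV" for n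
      by (cases n rule: int_cases2) auto
    thus ?thesis by auto
  qed
  finally have "?g summable_on UNIV" .
  thus ?thesis
    by (subst summable_on_reindex_bij_betw[where g = "\<lambda>n. n + m" and f = ?g and B = UNIV])
       (auto intro!: bij_betwI[where g = "\<lambda>n. n - m"])
qed

text \<open>The four series in \<open>\<Lambda>\<^sup>+\<close> and \<open>\<Lambda>\<^sup>-\<close> are all of this shape, with \<open>k = 0\<close> and \<open>k = 1\<close>
  respectively; the dual ones arise for \<open>(b, d) = (c, -a)\<close> after taking out \<open>e\<^bsup>-2\<pi>iac\<^esup>\<close>.\<close>

definition theta_term :: "nat \<Rightarrow> real \<Rightarrow> real \<Rightarrow> real \<Rightarrow> int \<Rightarrow> complex" where
  "theta_term k b d x n = exp (2 * of_real pi * \<i> * of_real b * of_int n)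
     * of_real ((of_int n + d) ^ k * exp (- pi * (of_int n + d)\<^sup>2 * x\<^sup>2))"

text \<open>The index set is a parameter so that the term \<open>n = - m\<close>, the only one to
  lose its decay as d tends to m, can be split off.\<close>

definition theta_mellin :: "nat \<Rightarrow> complex \<Rightarrow> real \<Rightarrow> real \<Rightarrow> int set \<Rightarrow> complex" where
  "theta_mellin k w b d A =
     (LINT x:{1..}|lborel. (\<Sum>\<^sub>\<infinity>n\<in>A. theta_term k b d x n) * of_real x powr (w - 1))"

section \<open>Bounds uniform in the parameters, and continuity\<close>

lemma norm_theta_term:
  "norm (theta_term k b d x n) = \<bar>of_int n + d\<bar> ^ k * exp (- pi * (of_int n + d)\<^sup>2 * x\<^sup>2)"
proof -
  have "norm (exp (2 * of_real pi * \<i> * of_real b * of_int n)) = 1"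
    by (simp add: norm_exp_eq_Re)
  thus ?thesis
    unfolding theta_term_def norm_mult[of "exp _"] norm_of_real by (simp add: abs_mult power_abs)
qed

text \<open>Away from \<open>n = - m\<close> one has |n + d| \<ge> |n + m| / 2, so the Gaussian
  decay is uniform in d. The majorant is a product of a summable function of \<open>n\<close> and a
  function of \<open>x\<close> that is integrable against every power, and so serves both the sum
  and the integral.\<close>

lemma norm_theta_term_le:
  assumes "k \<le> 1" "\<bar>d - of_int m\<bar> \<le> 1 / 2" "n \<noteq> - m" "x \<ge> 1"
  shows "norm (theta_term k b d x n) \<le> exp (- (1 / 4) * \<bar>of_int (n + m)\<bar>) * exp (- (1 / 4) * x)"
proof -
  define t where "t = \<bar>of_int n + d\<bar>"
  define j where "j = \<bar>real_of_int (n + m)\<bar>"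
  have j: "j \<ge> 1" using assms(3) unfolding j_def by linarith
  have t: "t \<ge> j / 2" using assms(2) j unfolding t_def j_def by (simp add: abs_if split: if_splits)
  have t2: "(of_int n + d)\<^sup>2 = t\<^sup>2" by (simp add: t_def)
  have tx: "t \<le> t * x" using assms(4) t j mult_left_mono[of 1 x t] by simp
  \<comment> \<open>With y = t x, the inequality 1 + y^2 \<le> e^(y^2) absorbs t^k, since 1 and t
    \<le> y are both at most 1 + y^2. This uses up 1 of the constant pi in the exponent, and pi - 1
    > 2 remains.\<close>
  have e: "1 + t * x * (t * x) \<le> exp (t * x * (t * x))" by (rule exp_ge_add_one_self)
  have "t * x \<le> 1 + t * x * (t * x)" 
    using zero_le_square[of "t * x - 1"] zero_le_square[of "t * x"] by (simp add: algebra_simps)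
  moreover have "1 \<le> 1 + t * x * (t * x)" using zero_le_square[of "t * x"] by linarith
  ultimately have "t \<le> exp (t * x * (t * x))" "1 \<le> exp (t * x * (t * x))"
    using e tx by linarith+
  hence "t ^ k \<le> exp (t * x * (t * x))"
    using assms(1) by (cases k) auto
  hence "t ^ k \<le> exp (t\<^sup>2 * x\<^sup>2)" by (simp add: power2_eq_square mult_ac)
  hence "norm (theta_term k b d x n) \<le> exp (t\<^sup>2 * x\<^sup>2) * exp (- pi * t\<^sup>2 * x\<^sup>2)"
    unfolding norm_theta_term t2 t_def[symmetric] by (intro mult_right_mono) auto
  also have "\<dots> = exp (- ((pi - 1) * (t\<^sup>2 * x\<^sup>2)))" by (simp add: algebra_simps flip: exp_add)
  also have "\<dots> \<le> exp (- (2 * (t\<^sup>2 * x\<^sup>2)))"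
    using pi_gt3 by (auto intro!: mult_right_mono)
  also have "\<dots> \<le> exp (- (1 / 4) * j + - (1 / 4) * x)"
  proof -
    have "j * x \<le> 2 * (t * x)" using t assms(4) by (simp add: mult_right_mono)
    hence "(j * x)\<^sup>2 \<le> (2 * (t * x))\<^sup>2" using j assms(4) by (intro power_mono) auto
    hence 1: "j\<^sup>2 * x\<^sup>2 \<le> 4 * (t\<^sup>2 * x\<^sup>2)" by (simp add: power_mult_distrib)
    \<comment> \<open>Both j and x are at most j^2 x^2, while 2 t^2 x^2 \<ge> j^2 x^2 / 2; splitting
      this half equally yields the two constants 1/4.\<close>
    have 2: "j * 1 \<le> j * (j * x\<^sup>2)" "x * 1 \<le> x * (j\<^sup>2 * x)"
      using j assms(4) by (intro mult_left_mono mult_ge1_I; simp add: one_le_power)+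
    show ?thesis using 1 2 by (simp add: power2_eq_square mult_ac)
  qed
  finally show ?thesis by (simp only: j_def exp_add)
qed

lemma summable_on_theta_term:
  assumes "k \<le> 1" "\<bar>d - of_int m\<bar> \<le> 1 / 2" "x \<ge> 1"
  shows "theta_term k b d x summable_on (- {- m})"
proof (rule abs_summable_summable, rule Infinite_Sum.abs_summable_on_comparison_test')
  show "(\<lambda>n. exp (- (1 / 4) * \<bar>of_int (n + m)\<bar>) * exp (- (1 / 4) * x)) summable_on (- {- m})"
    by (intro summable_on_cmult_left summable_on_subset_banach[OF summable_on_exp_minus_abs_int]) auto
qed (use norm_theta_term_le assms in auto)

lemma norm_infsum_theta_term_le:
  assumes "k \<le> 1" "\<bar>d - of_int m\<bar> \<le> 1 / 2" "x \<ge> 1"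
  shows "norm (\<Sum>\<^sub>\<infinity>n\<in>- {- m}. theta_term k b d x n)
           \<le> (\<Sum>\<^sub>\<infinity>n\<in>- {- m}. exp (- (1 / 4) * \<bar>of_int (n + m)\<bar>)) * exp (- (1 / 4) * x)"
proof (rule norm_infsum_le)
  show "(theta_term k b d x has_sum (\<Sum>\<^sub>\<infinity>n\<in>- {- m}. theta_term k b d x n)) (- {- m})"
    by (intro has_sum_infsum summable_on_theta_term assms)
  show "((\<lambda>n. exp (- (1 / 4) * \<bar>of_int (n + m)\<bar>) * exp (- (1 / 4) * x)) has_sum
      (\<Sum>\<^sub>\<infinity>n\<in>- {- m}. exp (- (1 / 4) * \<bar>of_int (n + m)\<bar>)) * exp (- (1 / 4) * x)) (- {- m})"
    by (intro has_sum_cmult_left has_sum_infsum summable_on_subset_banach[OF summable_on_exp_minus_abs_int]) auto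
qed (use norm_theta_term_le summable_on_theta_term assms in auto)

text \<open>Weierstrass M-test: the majorant in \<open>n\<close> is free of b, d and x, so the
  finite partial sums converge uniformly and joint continuity passes to the limit.\<close>

lemma continuous_on_infsum_theta_term:
  assumes "k \<le> 1"
  shows "continuous_on {(b, d, x). \<bar>d - of_int m\<bar> \<le> 1 / 2 \<and> x \<ge> 1}
           (\<lambda>(b, d, x). \<Sum>\<^sub>\<infinity>n\<in>- {- m}. theta_term k b d x n)" (is "continuous_on ?Y _")
proof (rule uniform_limit_theorem)
  show "uniform_limit ?Y (\<lambda>X (b, d, x). \<Sum>n\<in>X. theta_term k b d x n)
     (\<lambda>(b, d, x). \<Sum>\<^sub>\<infinity>n\<in>- {- m}. theta_term k b d x n) (finite_subsets_at_top (- {- m}))"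
    unfolding case_prod_unfold
  proof (rule Weierstrass_m_test_general)
    show "(\<lambda>n. exp (- (1 / 4) * \<bar>real_of_int (n + m)\<bar>)) summable_on (- {- m})"
      by (intro summable_on_subset_banach[OF summable_on_exp_minus_abs_int]) auto
    fix n and y :: "real \<times> real \<times> real" assume n: "n \<in> - {- m}" and y: "y \<in> {p. \<bar>fst (snd p) - of_int m\<bar> \<le> 1 / 2 \<and> snd (snd p) \<ge> (1::real)}"
    have "norm (theta_term k (fst y) (fst (snd y)) (snd (snd y)) n)
       \<le> exp (- (1 / 4) * \<bar>of_int (n + m)\<bar>) * exp (- (1 / 4) * snd (snd y))"
      using n y by (intro norm_theta_term_le assms) auto
    also have "\<dots> \<le> exp (- (1 / 4) * \<bar>of_int (n + m)\<bar>) * 1"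
      using y by (intro mult_left_mono) auto
    finally show "norm (theta_term k (fst y) (fst (snd y)) (snd (snd y)) n) \<le> exp (- (1 / 4) * \<bar>of_int (n + m)\<bar>)"
      by simp
  qed
  show "\<forall>\<^sub>F X in finite_subsets_at_top (- {- m}). continuous_on ?Y (\<lambda>(b, d, x). \<Sum>n\<in>X. theta_term k b d x n)"
    unfolding case_prod_unfold theta_term_def
    by (intro always_eventually allI continuous_intros)
qed simp

lemma continuous_on_infsum_theta_term':
  assumes "k \<le> 1" "\<bar>d - of_int m\<bar> \<le> 1 / 2"
  shows "continuous_on {1..} (\<lambda>x. \<Sum>\<^sub>\<infinity>n\<in>- {- m}. theta_term k b d x n)"
  using continuous_on_compose2[OF continuous_on_infsum_theta_term[OF assms(1)], of "{1..}" "\<lambda>x. (b, d, x)" m] assms(2)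
  by (force intro!: continuous_intros)

lemma theta_mellin_measurable:
  assumes "k \<le> 1" "\<bar>d - of_int m\<bar> \<le> 1 / 2"
  shows "set_borel_measurable lborel {1..} (\<lambda>x. (\<Sum>\<^sub>\<infinity>n\<in>- {- m}. theta_term k b d x n) * of_real x powr (w - 1))"
  by (intro set_borel_measurable_lborel_continuous_on continuous_intros continuous_on_infsum_theta_term' assms) auto

lemma theta_mellin_bound:
  assumes "k \<le> 1" "\<bar>d - of_int m\<bar> \<le> 1 / 2" "x \<ge> 1"
  shows "norm ((\<Sum>\<^sub>\<infinity>n\<in>- {- m}. theta_term k b d x n) * of_real x powr (w - 1))
     \<le> (\<Sum>\<^sub>\<infinity>n\<in>- {- m}. exp (- (1 / 4) * \<bar>of_int (n + m)\<bar>)) * (exp (- (1 / 4) * x) * x powr Re (w - 1))"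
proof -
  have "norm (complex_of_real x powr (w - 1)) = x powr Re (w - 1)"
    using assms by (simp add: norm_powr_real_powr)
  thus ?thesis
    unfolding norm_mult mult.assoc[symmetric]
    using norm_infsum_theta_term_le[OF assms, of b] by (simp add: mult_right_mono)
qed

lemma set_integrable_theta:
  assumes "k \<le> 1" "\<bar>d - of_int m\<bar> \<le> 1 / 2"
  shows "set_integrable lborel {1..} (\<lambda>x. (\<Sum>\<^sub>\<infinity>n\<in>- {- m}. theta_term k b d x n) * of_real x powr (w - 1))"
proof (rule set_integrable_bound[OF _ theta_mellin_measurable[OF assms]])
  show "set_integrable lborel {1..} (\<lambda>x. (\<Sum>\<^sub>\<infinity>n\<in>- {- m}. exp (- (1 / 4) * \<bar>of_int (n + m)\<bar>)) * (exp (- (1 / 4) * x) * x powr Re (w - 1)))"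
    by (intro set_integrable_mult_right set_integrable_exp_powr) auto
  show "AE x in lborel. x \<in> {1..} \<longrightarrow>
      norm ((\<Sum>\<^sub>\<infinity>n\<in>- {- m}. theta_term k b d x n) * of_real x powr (w - 1))
      \<le> norm ((\<Sum>\<^sub>\<infinity>n\<in>- {- m}. exp (- (1 / 4) * \<bar>real_of_int (n + m)\<bar>)) * (exp (- (1 / 4) * x) * x powr Re (w - 1)))"
    unfolding real_norm_def atLeast_iff
    by (intro AE_I2 impI order_trans[OF theta_mellin_bound[OF assms] abs_ge_self])
qed

text \<open>Dominated convergence along sequences: joint continuity gives pointwise convergence of
  the integrands, and \<open>theta_mellin_bound\<close> a majorant independent of b and d.\<close>

lemma isCont_theta_mellin:
  assumes k: "k \<le> 1"
  shows "isCont (\<lambda>(b, d). theta_mellin k w b d (- {- m})) (b0, of_int m)"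
proof (rule continuous_at_sequentiallyI)
  fix u :: "nat \<Rightarrow> real \<times> real" assume u: "u \<longlonglongrightarrow> (b0, of_int m)"
  have u1: "(\<lambda>i. fst (u i)) \<longlonglongrightarrow> b0" and u2: "(\<lambda>i. snd (u i)) \<longlonglongrightarrow> of_int m"
    using tendsto_fst[OF u] tendsto_snd[OF u] by auto
  have "\<forall>\<^sub>F i in sequentially. dist (snd (u i)) (of_int m) < 1 / 2"
    by (rule tendstoD[OF u2]) auto
  \<comment> \<open>Discarding the first \<open>N\<close> terms puts all remaining points into the
    strip where the bounds hold.\<close>
  then obtain N where N: "\<And>i. i \<ge> N \<Longrightarrow> \<bar>snd (u i) - of_int m\<bar> \<le> 1 / 2"
    by (force simp: eventually_sequentially dist_real_def)
  let ?F = "\<lambda>b d x. indicator {1..} x *\<^sub>R ((\<Sum>\<^sub>\<infinity>n\<in>- {- m}. theta_term k b d x n) * of_real x powr (w - 1))"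
  have "(\<lambda>i. integral\<^sup>L lborel (?F (fst (u (i + N))) (snd (u (i + N))))) \<longlonglongrightarrow> integral\<^sup>L lborel (?F b0 (of_int m))"
  proof (rule integral_dominated_convergence)
    show "integrable lborel (\<lambda>x. indicator {1..} x *\<^sub>R ((\<Sum>\<^sub>\<infinity>n\<in>- {- m}. exp (- (1 / 4) * \<bar>of_int (n + m)\<bar>)) * (exp (- (1 / 4) * x) * x powr Re (w - 1))))"
      unfolding set_integrable_def[symmetric] by (intro set_integrable_mult_right set_integrable_exp_powr) auto
    show "?F b0 (of_int m) \<in> borel_measurable lborel"
      using theta_mellin_measurable[OF k, of "of_int m" m b0 w] unfolding set_borel_measurable_def by simp
    show "?F (fst (u (i + N))) (snd (u (i + N))) \<in> borel_measurable lborel" for i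
      using theta_mellin_measurable[OF k N, of "i + N" "fst (u (i + N))" w] unfolding set_borel_measurable_def by simp
    show "AE x in lborel. norm (?F (fst (u (i + N))) (snd (u (i + N))) x) \<le>
       indicator {1..} x *\<^sub>R ((\<Sum>\<^sub>\<infinity>n\<in>- {- m}. exp (- (1 / 4) * \<bar>of_int (n + m)\<bar>)) * (exp (- (1 / 4) * x) * x powr Re (w - 1)))" for i
      using theta_mellin_bound[OF k N, of "i + N" _ "fst (u (i + N))" w] by (intro AE_I2) (auto simp: indicator_def)
    show "AE x in lborel. (\<lambda>i. ?F (fst (u (i + N))) (snd (u (i + N))) x) \<longlonglongrightarrow> ?F b0 (of_int m) x"
    proof (intro AE_I2)
      fix x :: real
      show "(\<lambda>i. ?F (fst (u (i + N))) (snd (u (i + N))) x) \<longlonglongrightarrow> ?F b0 (of_int m) x"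
      proof (cases "x \<ge> 1")
        case True
        have "(\<lambda>i. (\<lambda>(b, d, x). \<Sum>\<^sub>\<infinity>n\<in>- {- m}. theta_term k b d x n) (fst (u (i + N)), snd (u (i + N)), x))
           \<longlonglongrightarrow> (\<lambda>(b, d, x). \<Sum>\<^sub>\<infinity>n\<in>- {- m}. theta_term k b d x n) (b0, of_int m, x)"
          by (rule continuous_on_tendsto_compose[OF continuous_on_infsum_theta_term[OF k, of m]])
             (use True N LIMSEQ_ignore_initial_segment[OF u1] LIMSEQ_ignore_initial_segment[OF u2] 
               in \<open>auto intro!: tendsto_intros always_eventually\<close>)
        thus ?thesis by (auto intro!: tendsto_intros)
      qed auto
    qed
  qed
  hence "(\<lambda>i. integral\<^sup>L lborel (?F (fst (u i)) (snd (u i)))) \<longlonglongrightarrow> integral\<^sup>L lborel (?F b0 (of_int m))"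
    by (rule LIMSEQ_offset)
  thus "(\<lambda>i. case u i of (b, d) \<Rightarrow> theta_mellin k w b d (- {- m}))
      \<longlonglongrightarrow> (case (b0, real_of_int m) of (b, d) \<Rightarrow> theta_mellin k w b d (- {- m}))"
    by (simp add: theta_mellin_def set_lebesgue_integral_def case_prod_unfold)
qed

text \<open>For \<open>n = - m\<close> the square (n + d)^2 is |d - m|^2, so this single term has a
  truncated Gaussian transform, multiplied by its phase and by (d - m)^k.\<close>

lemma theta_mellin_split:
  assumes k: "k \<le> 1" and d: "\<bar>d - of_int m\<bar> \<le> 1 / 2" "d \<noteq> of_int m"
  shows "theta_mellin k w b d UNIV = theta_mellin k w b d (- {- m})
     + exp (- 2 * of_real pi * \<i> * of_real b * of_int m) * of_real ((d - of_int m) ^ k) * gauss_mellin w \<bar>d - of_int m\<bar>"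
proof -
  define E where "E = exp (- 2 * of_real pi * \<i> * of_real b * of_int m) * complex_of_real ((d - of_int m) ^ k)"
  have "theta_mellin k w b d UNIV = (LINT x:{1..}|lborel. (\<Sum>\<^sub>\<infinity>n\<in>- {- m}. theta_term k b d x n) * of_real x powr (w - 1)
      + E * (of_real (exp (- pi * \<bar>d - of_int m\<bar>\<^sup>2 * x\<^sup>2)) * of_real x powr (w - 1)))"
    unfolding theta_mellin_def
  proof (rule set_lebesgue_integral_cong; (intro allI impI)?)
    fix x :: real assume "x \<in> {1..}"
    hence x: "x \<ge> 1" by simp
    have "(\<Sum>\<^sub>\<infinity>n\<in>- {- m} \<union> {- m}. theta_term k b d x n) = (\<Sum>\<^sub>\<infinity>n\<in>- {- m}. theta_term k b d x n) + infsum (theta_term k b d x) {- m}"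
      by (intro infsum_Un_disjoint summable_on_theta_term k d x) auto
    moreover have "- {- m} \<union> {- m} = UNIV" by auto
    moreover have "theta_term k b d x (- m) = E * of_real (exp (- pi * \<bar>d - of_int m\<bar>\<^sup>2 * x\<^sup>2))"
      by (simp add: theta_term_def E_def)
    ultimately show "(\<Sum>\<^sub>\<infinity>n\<in>UNIV. theta_term k b d x n) * of_real x powr (w - 1) = (\<Sum>\<^sub>\<infinity>n\<in>- {- m}. theta_term k b d x n) * of_real x powr (w - 1)
      + E * (of_real (exp (- pi * \<bar>d - of_int m\<bar>\<^sup>2 * x\<^sup>2)) * of_real x powr (w - 1))"
      by (simp add: algebra_simps)
  qed auto
  also have "\<dots> = theta_mellin k w b d (- {- m}) + E * gauss_mellin w \<bar>d - of_int m\<bar>"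
    unfolding theta_mellin_def gauss_mellin_def
    using set_integrable_theta[OF k d(1), of b w] set_integrable_gauss[of "\<bar>d - of_int m\<bar>" w] d(2)
    by (subst set_integral_add) auto
  finally show ?thesis by (simp add: E_def)
qed


section \<open>Behaviour at the corners\<close>

text \<open>The index convention of \<open>Lambda_plus\<close>: nothing is left out unless d is an
  integer, and then exactly the exceptional term. One function thus covers the corner and its
  neighbourhood.\<close>

definition theta_full :: "nat \<Rightarrow> complex \<Rightarrow> real \<Rightarrow> real \<Rightarrow> complex" where
  "theta_full k w b d = theta_mellin k w b d {n. of_int n \<noteq> - d}"

lemma near_int_not_int:
  fixes d :: real
  assumes "\<bar>d - of_int m\<bar> \<le> 1 / 2" "d \<noteq> of_int m"
  shows "d \<notin> \<int>"
proof
  assume "d \<in> \<int>"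
  then obtain j where "d = of_int j" by (elim Ints_cases)
  with assms have "\<bar>real_of_int (j - m)\<bar> < 1" "j \<noteq> m" by auto
  thus False by linarith
qed

lemma theta_full_int: "theta_full k w b (of_int m) = theta_mellin k w b (of_int m) (- {- m})"
proof -
  have "{n. real_of_int n \<noteq> - of_int m} = - {- m}"
    by (auto simp flip: of_int_minus)
  thus ?thesis by (simp add: theta_full_def)
qed

lemma theta_full_not_int:
  assumes "d \<notin> \<int>"
  shows "theta_full k w b d = theta_mellin k w b d UNIV"
proof -
  have "real_of_int n \<noteq> - d" for n
    using assms by (metis Ints_minus Ints_of_int minus_minus)
  thus ?thesis by (simp add: theta_full_def)
qed

lemma tendsto_gauss_mellin_diff_pow:
  assumes "k \<le> 1" "\<And>n. w \<noteq> - of_nat n" "(d \<longlongrightarrow> of_int m) F" "\<forall>\<^sub>F p in F. d p \<noteq> of_int m"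
  shows "((\<lambda>p. of_real ((d p - of_int m) ^ k)
             * (gauss_mellin w \<bar>d p - of_int m\<bar> - gauss_sing w \<bar>d p - of_int m\<bar>))
           \<longlongrightarrow> of_real ((of_int m - of_int m) ^ k) * (- 1 / w)) F"
proof -
  have "((\<lambda>p. \<bar>d p - of_int m\<bar>) \<longlongrightarrow> \<bar>of_int m - of_int m\<bar>) F"
    by (intro tendsto_intros assms)
  \<comment> \<open>As d eventually avoids m, the distance tends to 0 strictly from the right, where
    the limit -1/w is available.\<close>
  hence "filterlim (\<lambda>p. \<bar>d p - of_int m\<bar>) (at_right 0) F"
    using assms(4) by (auto simp: filterlim_at elim!: eventually_mono)
  from filterlim_compose[OF tendsto_gauss_mellin_diff[OF assms(2)] this]
  show ?thesis by (intro tendsto_mult tendsto_of_real tendsto_power tendsto_diff tendsto_const assms)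
qed

text \<open>The factor \<open>0 ^ k\<close>, with \<open>0 ^ 0 = 1\<close>, records that the limit
  -1/w survives for \<open>k = 0\<close> and is killed by d - m for \<open>k = 1\<close>.\<close>

lemma tendsto_theta_full:
  assumes k: "k \<le> 1" and w: "\<And>n. w \<noteq> - of_nat n"
    and b: "(b \<longlongrightarrow> b0) F" and d: "(d \<longlongrightarrow> of_int m) F" and nd: "\<forall>\<^sub>F p in F. d p \<noteq> of_int m"
  shows "((\<lambda>p. theta_full k w (b p) (d p)
             - exp (- 2 * of_real pi * \<i> * of_real (b p) * of_int m)
               * of_real ((d p - of_int m) ^ k) * gauss_sing w \<bar>d p - of_int m\<bar>)
           \<longlongrightarrow> theta_full k w b0 (of_int m) - exp (- 2 * of_real pi * \<i> * of_real b0 * of_int m) * 0 ^ k / w) F"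
proof -
  let ?E = "\<lambda>b. exp (- 2 * of_real pi * \<i> * complex_of_real b * of_int m)"
  let ?D = "\<lambda>p. of_real ((d p - of_int m) ^ k)
             * (gauss_mellin w \<bar>d p - of_int m\<bar> - gauss_sing w \<bar>d p - of_int m\<bar>)"
  have "((\<lambda>p. theta_mellin k w (b p) (d p) (- {- m})) \<longlongrightarrow> theta_mellin k w b0 (of_int m) (- {- m})) F"
    using isCont_tendsto_compose[OF isCont_theta_mellin[OF k] tendsto_Pair[OF b d], of w] by simp
  moreover have "((\<lambda>p. ?E (b p)) \<longlongrightarrow> ?E b0) F"
    by (intro tendsto_intros b)
  ultimately have "((\<lambda>p. theta_mellin k w (b p) (d p) (- {- m}) + ?E (b p) * ?D p)
      \<longlongrightarrow> theta_mellin k w b0 (of_int m) (- {- m}) + ?E b0 * (of_real ((of_int m - of_int m) ^ k) * (- 1 / w))) F"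
    by (intro tendsto_add tendsto_mult tendsto_gauss_mellin_diff_pow k w d nd)
  hence "((\<lambda>p. theta_mellin k w (b p) (d p) (- {- m}) + ?E (b p) * ?D p)
      \<longlongrightarrow> theta_full k w b0 (of_int m) - ?E b0 * 0 ^ k / w) F"
    by (simp add: theta_full_int)
  moreover have "\<forall>\<^sub>F p in F. dist (d p) (of_int m) < 1 / 2"
    by (rule tendstoD[OF d]) auto
  with nd have "\<forall>\<^sub>F p in F. theta_mellin k w (b p) (d p) (- {- m}) + ?E (b p) * ?D p
      = theta_full k w (b p) (d p) - ?E (b p) * of_real ((d p - of_int m) ^ k) * gauss_sing w \<bar>d p - of_int m\<bar>"
  proof eventually_elim
    case (elim p)
    hence le: "\<bar>d p - of_int m\<bar> \<le> 1 / 2" by (simp add: dist_real_def)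
    show ?case
      unfolding theta_full_not_int[OF near_int_not_int[OF le elim(1)]] theta_mellin_split[OF k le elim(1)]
      by (simp add: algebra_simps)
  qed
  ultimately show ?thesis by (rule Lim_transform_eventually)
qed

section \<open>The functions Lambda in terms of theta transforms\<close>

lemma Lambda_plus_theta:
  "Lambda_plus s a c = 2 * theta_full 0 s a c
     + 2 * (exp (- 2 * of_real pi * \<i> * of_real a * of_real c) * theta_full 0 (1 - s) c (- a))
     + 2 * delta_Z a / (s - 1)
     - 2 * delta_Z c * exp (- 2 * of_real pi * \<i> * of_real a * of_real c) / s"
proof -
  let ?e = "exp (- 2 * of_real pi * \<i> * of_real a * complex_of_real c)"
  have ex: "exp (2 * of_real pi * \<i> * of_real c * of_real (of_int n - a)) = ?e * exp (2 * of_real pi * \<i> * of_real c * of_int n)" for n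
    by (simp add: algebra_simps flip: exp_add)
  have "exp (2 * of_real pi * \<i> * of_real c * of_real (of_int n - a)) * of_real (exp (- pi * (of_int n - a)\<^sup>2 * y\<^sup>2))
      = ?e * theta_term 0 c (- a) y n" for n y
    unfolding theta_term_def ex by simp
  thus ?thesis
    by (simp add: Lambda_plus_def theta_full_def theta_mellin_def theta_term_def[of 0 a]
        infsum_cmult_right' mult.assoc flip: set_integral_mult_right)
qed

lemma Lambda_minus_theta:
  "Lambda_minus s a c = 2 * theta_full 1 (s + 1) a c
     - 2 * \<i> * (exp (- 2 * of_real pi * \<i> * of_real a * of_real c) * theta_full 1 (2 - s) c (- a))"
proof -
  let ?e = "exp (- 2 * of_real pi * \<i> * of_real a * complex_of_real c)"
  have ex: "exp (2 * of_real pi * \<i> * of_real c * of_real (of_int n - a)) = ?e * exp (2 * of_real pi * \<i> * of_real c * of_int n)" for n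
    by (simp add: algebra_simps flip: exp_add)
  have 1: "exp (2 * of_real pi * \<i> * of_real c * of_real (of_int n - a)) * of_real ((of_int n - a) * exp (- pi * (of_int n - a)\<^sup>2 * y\<^sup>2))
      = ?e * theta_term 1 c (- a) y n" for n y
    unfolding theta_term_def ex by simp
  have 2: "exp (2 * of_real pi * \<i> * of_real a * of_int n) * of_real ((of_int n + c) * exp (- pi * (of_int n + c)\<^sup>2 * x\<^sup>2))
      = theta_term 1 a c x n" for n x
    by (simp add: theta_term_def)
  \<comment> \<open>\<open>Lambda_minus\<close> sums over all n; the term \<open>n = - d\<close> may
    be dropped because its factor n + d is 0.\<close>
  have 3: "(\<Sum>\<^sub>\<infinity>n\<in>UNIV. theta_term 1 b d x n) = (\<Sum>\<^sub>\<infinity>n\<in>{n. of_int n \<noteq> - d}. theta_term 1 b d x n)" for b d x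
    by (rule infsum_cong_neutral) (auto simp: theta_term_def)
  \<comment> \<open>The weights x^s and y^(1-s) have the form x^(w-1) with w = s + 1 and w = 2 -
    s.\<close>
  show ?thesis
    unfolding Lambda_minus_def 1 2 infsum_cmult_right' 3
    by (simp add: theta_full_def theta_mellin_def mult.assoc flip: set_integral_mult_right)
qed

section \<open>Gamma factors of the singular parts\<close>

lemma Gamma_half_nonzero:
  fixes w :: complex
  assumes "w \<notin> \<int>"
  shows "Gamma (w / 2) \<noteq> 0"
proof
  assume "Gamma (w / 2) = 0"
  then obtain n where "w / 2 = - of_nat n"
    by (auto simp: Gamma_eq_zero_iff elim!: nonpos_Ints_cases')
  hence "w = of_int (- 2 * int n)" by (simp add: field_simps)
  thus False using assms Ints_of_int by metis
qed

lemma gauss_sing_plus: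
  assumes "s \<notin> \<int>"
  shows "of_real pi powr (s / 2) / Gamma (s / 2) * (2 * gauss_sing s u) = of_real u powr (- s)"
  using Gamma_half_nonzero[OF assms] by (simp add: gauss_sing_def powr_minus)

text \<open>The factor \<open>u\<close> compensates the shift from s to s + 1, so the result is the
  same power as in \<open>gauss_sing_plus\<close>. The two contributions will add up or cancel
  according to the sign of c - m.\<close>

lemma gauss_sing_minus:
  assumes "s \<notin> \<int>" "u > 0"
  shows "of_real pi powr ((s + 1) / 2) / Gamma ((s + 1) / 2) * (2 * (of_real u * gauss_sing (s + 1) u)) = of_real u powr (- s)"
proof -
  have "s + 1 \<notin> \<int>" using assms(1) by (metis Ints_1 Ints_diff add_diff_cancel_right')
  moreover have "complex_of_real u powr (- (s + 1)) = of_real u powr (- s) / of_real u"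
    using assms(2) by (simp add: powr_diff)
  ultimately show ?thesis
    using Gamma_half_nonzero[of "s + 1"] assms(2) unfolding gauss_sing_def
    by (simp add: powr_minus[of _ "(s + 1) / 2"])
qed

lemma gauss_sing_dual_plus:
  "of_real pi powr (s / 2) / Gamma (s / 2) * (2 * gauss_sing (1 - s) v) = gamma_ratio s * of_real v powr (s - 1)"
  by (simp add: gauss_sing_def gamma_ratio_def powr_minus[of _ "s / 2"] divide_simps)

text \<open>Reflection at s/2 and at (s+1)/2 expresses Gamma((2-s)/2) and Gamma((s+1)/2) through the
  Gamma values in \<open>gamma_ratio\<close>; the cosine and sine that arise form the
  cotangent.\<close>

lemma gauss_sing_dual_minus:
  assumes "s \<notin> \<int>" "v > 0"
  shows "of_real pi powr ((s + 1) / 2) / Gamma ((s + 1) / 2) * (2 * (of_real v * gauss_sing (2 - s) v))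
     = gamma_ratio s * cot (of_real pi * s / 2) * of_real v powr (s - 1)"
proof -
  have "1 - s \<notin> \<int>" "2 - s \<notin> \<int>" "s + 1 \<notin> \<int>"
    using assms(1) Ints_diff[of 1 "1 - s"] Ints_diff[of 2 "2 - s"] Ints_diff[of "s + 1" 1] by auto
  hence nz: "Gamma (s / 2) \<noteq> 0" "Gamma ((1 - s) / 2) \<noteq> 0" "Gamma ((2 - s) / 2) \<noteq> 0" "Gamma ((s + 1) / 2) \<noteq> 0"
    using assms(1) Gamma_half_nonzero by blast+
  have half: "1 - s / 2 = (2 - s) / 2" "1 - (s + 1) / 2 = (1 - s) / 2" by (simp_all add: field_simps)
  have r1: "Gamma (s / 2) * Gamma ((2 - s) / 2) = of_real pi / sin (of_real pi * s / 2)"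
    using Gamma_reflection_complex[of "s / 2"] unfolding half by simp
  have "sin (of_real pi * ((s + 1) / 2)) = cos (of_real pi * s / 2)"
    by (simp add: sin_add sin_pi_half cos_pi_half distrib_left add_divide_distrib flip: sin_of_real cos_of_real)
  hence r2: "Gamma ((s + 1) / 2) * Gamma ((1 - s) / 2) = of_real pi / cos (of_real pi * s / 2)"
    using Gamma_reflection_complex[of "(s + 1) / 2"] unfolding half by simp
  \<comment> \<open>A zero of sine or cosine would make the right side of \<open>r1\<close> or
    \<open>r2\<close> equal to 0, as division by zero gives 0, but the Gamma products are
    nonzero.\<close>
  have sc: "sin (of_real pi * s / 2) \<noteq> 0" "cos (of_real pi * s / 2) \<noteq> 0"
    using r1 r2 nz by auto
  have G: "Gamma ((2 - s) / 2) / Gamma ((s + 1) / 2) = Gamma ((1 - s) / 2) / Gamma (s / 2) * cot (of_real pi * s / 2)"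
  proof -
    have "Gamma ((2 - s) / 2) = of_real pi / (sin (of_real pi * s / 2) * Gamma (s / 2))"
      using r1 sc nz by (simp add: field_simps)
    moreover have "Gamma ((s + 1) / 2) = of_real pi / (cos (of_real pi * s / 2) * Gamma ((1 - s) / 2))"
      using r2 sc nz by (simp add: field_simps)
    ultimately show ?thesis by (simp add: cot_def mult_ac)
  qed
  have P: "of_real pi powr ((s + 1) / 2) * of_real pi powr (- ((2 - s) / 2))
      = of_real pi powr (- ((1 - s) / 2)) / (of_real pi powr (- (s / 2)) :: complex)"
  proof -
    have "(s + 1) / 2 + - ((2 - s) / 2) = - ((1 - s) / 2) - - (s / 2)" by (simp add: field_simps)
    thus ?thesis by (simp only: flip: powr_add powr_diff)
  qed
  have V: "of_real v * complex_of_real v powr (- (2 - s)) = of_real v powr (s - 1)"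
    using assms(2) by (simp add: powr_diff power2_eq_square)
  have "of_real pi powr ((s + 1) / 2) / Gamma ((s + 1) / 2) * (2 * (of_real v * gauss_sing (2 - s) v))
      = (of_real pi powr ((s + 1) / 2) * of_real pi powr (- ((2 - s) / 2)))
        * (Gamma ((2 - s) / 2) / Gamma ((s + 1) / 2)) * (of_real v * complex_of_real v powr (- (2 - s)))"
    by (simp add: gauss_sing_def)
  also have "\<dots> = gamma_ratio s * cot (of_real pi * s / 2) * of_real v powr (s - 1)"
    unfolding P G V gamma_ratio_def by simp
  finally show ?thesis .
qed

text \<open>Treats all four corners at once. Here \<sigma> is the sign of c - m and \<tau> that of l
  - a, the latter because the dual series has the shift -a, tending to -l. The factor 1 + \<sigma>
  is 0 for c approaching 1 from below and 2 for c approaching 0 from above.\<close>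

lemma lerch_zeta_star_corner:
  fixes a c :: "'p \<Rightarrow> real" and l m :: int and \<sigma> \<tau> :: real
  assumes s: "s \<notin> \<int>"
    and a: "(a \<longlongrightarrow> of_int l) F" and c: "(c \<longlongrightarrow> of_int m) F"
    and na: "\<forall>\<^sub>F p in F. a p \<noteq> of_int l \<and> of_int l - a p = \<tau> * \<bar>a p - of_int l\<bar>"
    and nc: "\<forall>\<^sub>F p in F. c p \<noteq> of_int m \<and> c p - of_int m = \<sigma> * \<bar>c p - of_int m\<bar>"
  shows "((\<lambda>p. lerch_zeta_star s (a p) (c p)
       - (1 / 2 * (1 + of_real \<sigma>) * exp (- 2 * of_real pi * \<i> * of_real (a p) * of_int m)
            * of_real \<bar>c p - of_int m\<bar> powr (- s)
        + 1 / 2 * gamma_ratio s * (1 - \<i> * of_real \<tau> * cot (of_real pi * s / 2))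
            * exp (2 * of_real pi * \<i> * of_real (of_int l - a p) * of_real (c p))
            * of_real \<bar>a p - of_int l\<bar> powr (s - 1)))
     \<longlongrightarrow> lerch_zeta_star s (of_int l) (of_int m)) F"
proof -
  define P where "P = of_real pi powr (s / 2) / Gamma (s / 2)"
  define Q where "Q = of_real pi powr ((s + 1) / 2) / Gamma ((s + 1) / 2)"
  define e where "e = (\<lambda>a c. exp (- 2 * of_real pi * \<i> * of_real a * complex_of_real c))"
  \<comment> \<open>Phases of the exceptional terms: \<open>n = - m\<close> in the direct series and
    \<open>n = l\<close> in the dual one. \<open>T1\<close> and \<open>T2\<close> are the transforms
    with their singular parts removed.\<close>
  define E1 where "E1 = (\<lambda>a. exp (- 2 * of_real pi * \<i> * complex_of_real a * of_int m))"
  define E2 where "E2 = (\<lambda>c. exp (- 2 * of_real pi * \<i> * complex_of_real c * of_int (- l)))"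
  define T1 where "T1 = (\<lambda>k w p. theta_full k w (a p) (c p)
     - E1 (a p) * of_real ((c p - of_int m) ^ k) * gauss_sing w \<bar>c p - of_int m\<bar>)"
  define T2 where "T2 = (\<lambda>k w p. theta_full k w (c p) (- a p)
     - E2 (c p) * of_real ((- a p - of_int (- l)) ^ k) * gauss_sing w \<bar>- a p - of_int (- l)\<bar>)"
  \<comment> \<open>As s is not an integer, none of the exponents s, 1 - s, s + 1, 2 - s is a
    nonpositive integer.\<close>
  have notint: "j + s \<noteq> - of_nat n" "j - s \<noteq> - of_nat n" if "j \<in> \<int>" for j n
    using s that
    by (metis Ints_diff Ints_minus Ints_of_nat add_diff_cancel_left', metis Ints_diff Ints_minus Ints_of_nat diff_diff_eq2 add_diff_cancel_left')
  have nc': "\<forall>\<^sub>F p in F. c p \<noteq> of_int m" using nc by (auto elim: eventually_mono)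
  have na': "\<forall>\<^sub>F p in F. - a p \<noteq> of_int (- l)" using na by (auto elim: eventually_mono)
  have a': "((\<lambda>p. - a p) \<longlongrightarrow> of_int (- l)) F" using tendsto_minus[OF a] by simp
  have T1: "(T1 k w \<longlongrightarrow> theta_full k w (of_int l) (of_int m) - E1 (of_int l) * 0 ^ k / w) F"
    if "k \<le> 1" "\<And>n. w \<noteq> - of_nat n" for k w
    unfolding T1_def E1_def using that by (intro tendsto_theta_full a c nc')
  have T2: "(T2 k w \<longlongrightarrow> theta_full k w (of_int m) (of_int (- l)) - E2 (of_int m) * 0 ^ k / w) F"
    if "k \<le> 1" "\<And>n. w \<noteq> - of_nat n" for k w
    unfolding T2_def E2_def using that by (intro tendsto_theta_full a' c na')
  have "((\<lambda>p. e (a p) (c p)) \<longlongrightarrow> e (of_int l) (of_int m)) F"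
    unfolding e_def by (intro tendsto_intros a c)
  hence lim: "((\<lambda>p. 1 / 2 * (P * (2 * T1 0 s p + 2 * (e (a p) (c p) * T2 0 (1 - s) p))
           + Q * (2 * T1 1 (s + 1) p - 2 * \<i> * (e (a p) (c p) * T2 1 (2 - s) p)))) \<longlongrightarrow>
      1 / 2 * (P * (2 * (theta_full 0 s (of_int l) (of_int m) - E1 (of_int l) * 0 ^ 0 / s)
           + 2 * (e (of_int l) (of_int m) * (theta_full 0 (1 - s) (of_int m) (of_int (- l)) - E2 (of_int m) * 0 ^ 0 / (1 - s))))
         + Q * (2 * (theta_full 1 (s + 1) (of_int l) (of_int m) - E1 (of_int l) * 0 ^ 1 / (s + 1))
           - 2 * \<i> * (e (of_int l) (of_int m) * (theta_full 1 (2 - s) (of_int m) (of_int (- l)) - E2 (of_int m) * 0 ^ 1 / (2 - s)))))) F"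
    using notint(1)[of 0] notint(1)[of 1] notint(2)[of 1] notint(2)[of 2]
    by (intro tendsto_intros T1 T2) (auto simp: add.commute)
  \<comment> \<open>At the corner the dual phase cancels \<open>e\<close>, so the dual limit
    contributes -1/(1-s) = 1/(s-1) and the direct one -e/s. These are the two polar terms of
    \<open>Lambda_plus\<close>.\<close>
  have eE2: "e (of_int l) (of_int m) * E2 (of_int m) = 1"
    by (simp add: e_def E2_def flip: exp_add)
  have pole: "x / (s - 1) = - (x / (1 - s))" for x :: complex
    by (metis minus_diff_eq minus_divide_right)
  have "1 / 2 * (P * (2 * (theta_full 0 s (of_int l) (of_int m) - E1 (of_int l) * 0 ^ 0 / s)
           + 2 * (e (of_int l) (of_int m) * (theta_full 0 (1 - s) (of_int m) (of_int (- l)) - E2 (of_int m) * 0 ^ 0 / (1 - s))))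
         + Q * (2 * (theta_full 1 (s + 1) (of_int l) (of_int m) - E1 (of_int l) * 0 ^ 1 / (s + 1))
           - 2 * \<i> * (e (of_int l) (of_int m) * (theta_full 1 (2 - s) (of_int m) (of_int (- l)) - E2 (of_int m) * 0 ^ 1 / (2 - s)))))
      = lerch_zeta_star s (of_int l) (of_int m)"
    unfolding right_diff_distrib times_divide_eq_right mult.assoc[symmetric] eE2
    by (simp add: lerch_zeta_star_def Lambda_plus_theta Lambda_minus_theta delta_Z_def P_def Q_def e_def E1_def
         pole algebra_simps)
  note lim = lim[unfolded this]
  have "\<forall>\<^sub>F p in F. dist (a p) (of_int l) < 1 / 2" "\<forall>\<^sub>F p in F. dist (c p) (of_int m) < 1 / 2"
    by (rule tendstoD[OF a] tendstoD[OF c]; simp)+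
  with na nc have "\<forall>\<^sub>F p in F. 1 / 2 * (P * (2 * T1 0 s p + 2 * (e (a p) (c p) * T2 0 (1 - s) p))
           + Q * (2 * T1 1 (s + 1) p - 2 * \<i> * (e (a p) (c p) * T2 1 (2 - s) p))) = lerch_zeta_star s (a p) (c p)
       - (1 / 2 * (1 + of_real \<sigma>) * exp (- 2 * of_real pi * \<i> * of_real (a p) * of_int m)
            * of_real \<bar>c p - of_int m\<bar> powr (- s)
        + 1 / 2 * gamma_ratio s * (1 - \<i> * of_real \<tau> * cot (of_real pi * s / 2))
            * exp (2 * of_real pi * \<i> * of_real (of_int l - a p) * of_real (c p))
            * of_real \<bar>a p - of_int l\<bar> powr (s - 1))"
  proof eventually_elim
    case (elim p)
    define u where "u = \<bar>c p - of_int m\<bar>"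
    define v where "v = \<bar>a p - of_int l\<bar>"
    define H where "H = exp (2 * of_real pi * \<i> * of_real (of_int l - a p) * complex_of_real (c p))"
    have pos: "u > 0" "v > 0" using elim by (auto simp: u_def v_def)
    \<comment> \<open>Near the corner neither coordinate is an integer, so the polar terms are
      absent here although they are present in the limit.\<close>
    have "delta_Z (a p) = 0" "delta_Z (c p) = 0"
      using elim near_int_not_int[of "a p" l] near_int_not_int[of "c p" m]
      by (auto simp: delta_Z_def dist_real_def)
    hence lz: "lerch_zeta_star s (a p) (c p) = 1 / 2 * (P * (2 * theta_full 0 s (a p) (c p) + 2 * (e (a p) (c p) * theta_full 0 (1 - s) (c p) (- a p)))
        + Q * (2 * theta_full 1 (s + 1) (a p) (c p) - 2 * \<i> * (e (a p) (c p) * theta_full 1 (2 - s) (c p) (- a p))))"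
      by (simp add: lerch_zeta_star_def Lambda_plus_theta Lambda_minus_theta P_def Q_def e_def)
    have H: "e (a p) (c p) * E2 (c p) = H"
      by (simp add: e_def E2_def H_def algebra_simps flip: exp_add)
    have cm: "c p - of_int m = \<sigma> * u" and al: "- a p - of_int (- l) = \<tau> * v" and av: "\<bar>- a p - of_int (- l)\<bar> = v"
      using elim by (auto simp: u_def v_def)
    have T1p: "T1 k w p = theta_full k w (a p) (c p) - E1 (a p) * of_real ((\<sigma> * u) ^ k) * gauss_sing w u" for k w
      unfolding T1_def cm[symmetric] by (simp only: u_def)
    have T2p: "e (a p) (c p) * T2 k w p = e (a p) (c p) * theta_full k w (c p) (- a p) - H * of_real ((\<tau> * v) ^ k) * gauss_sing w v" for k w
      unfolding T2_def al[symmetric] av H[symmetric] by (simp only: right_diff_distrib mult.assoc)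
    have "P * (2 * T1 0 s p + 2 * (e (a p) (c p) * T2 0 (1 - s) p))
           + Q * (2 * T1 1 (s + 1) p - 2 * \<i> * (e (a p) (c p) * T2 1 (2 - s) p))
       = (P * (2 * theta_full 0 s (a p) (c p) + 2 * (e (a p) (c p) * theta_full 0 (1 - s) (c p) (- a p)))
        + Q * (2 * theta_full 1 (s + 1) (a p) (c p) - 2 * \<i> * (e (a p) (c p) * theta_full 1 (2 - s) (c p) (- a p))))
       - (E1 (a p) * (P * (2 * gauss_sing s u)) + \<sigma> * E1 (a p) * (Q * (2 * (of_real u * gauss_sing (s + 1) u)))
        + H * (P * (2 * gauss_sing (1 - s) v)) - \<i> * \<tau> * H * (Q * (2 * (of_real v * gauss_sing (2 - s) v))))"
      unfolding T1p T2p by (simp add: algebra_simps)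
    \<comment> \<open>The first two terms combine to the coefficient 1 + \<sigma>, the last two to 1
      - i \<tau> cot(pi s/2).\<close>
    also have "E1 (a p) * (P * (2 * gauss_sing s u)) + \<sigma> * E1 (a p) * (Q * (2 * (of_real u * gauss_sing (s + 1) u)))
        + H * (P * (2 * gauss_sing (1 - s) v)) - \<i> * \<tau> * H * (Q * (2 * (of_real v * gauss_sing (2 - s) v)))
       = (1 + of_real \<sigma>) * E1 (a p) * of_real u powr (- s)
          + gamma_ratio s * (1 - \<i> * of_real \<tau> * cot (of_real pi * s / 2)) * H * of_real v powr (s - 1)"
      unfolding P_def Q_def gauss_sing_plus[OF s] gauss_sing_minus[OF s pos(1)]
        gauss_sing_dual_plus gauss_sing_dual_minus[OF s pos(2)]
      by (simp add: algebra_simps)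
    finally have eq: "P * (2 * T1 0 s p + 2 * (e (a p) (c p) * T2 0 (1 - s) p))
           + Q * (2 * T1 1 (s + 1) p - 2 * \<i> * (e (a p) (c p) * T2 1 (2 - s) p))
       = 2 * lerch_zeta_star s (a p) (c p) - ((1 + of_real \<sigma>) * E1 (a p) * of_real u powr (- s)
          + gamma_ratio s * (1 - \<i> * of_real \<tau> * cot (of_real pi * s / 2)) * H * of_real v powr (s - 1))"
      unfolding lz by simp
    have half: "1 / 2 * (2 * x - (y + z)) = x - (1 / 2 * y + 1 / 2 * z)" for x y z :: complex
      by (simp add: field_simps)
    show ?case
      unfolding eq half H_def E1_def u_def v_def by (simp only: mult.assoc)
  qed
  with lim show ?thesis by (rule Lim_transform_eventually)
qed

theorem theorem6p3:
  fixes s :: complex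
  assumes "s \<notin> \<int>"
  shows
    "((\<lambda>(a, c). lerch_zeta_star s a c
         - 1 / 2 * gamma_ratio s * (1 - \<i> * cot (of_real pi * s / 2))
           * exp (2 * of_real pi * \<i> * of_real (1 - a) * of_real c)
           * of_real (1 - a) powr (s - 1))
       \<longlongrightarrow> lerch_zeta_star s 1 1)
       (at (1, 1) within {0<..<1} \<times> {0<..<1})
   \<and> ((\<lambda>(a, c). lerch_zeta_star s a c
         - 1 / 2 * gamma_ratio s * (1 + \<i> * cot (of_real pi * s / 2))
           * exp (- 2 * of_real pi * \<i> * of_real a * of_real c)
           * of_real a powr (s - 1))
       \<longlongrightarrow> lerch_zeta_star s 0 1)
       (at (0, 1) within {0<..<1} \<times> {0<..<1})
   \<and> ((\<lambda>(a, c). lerch_zeta_star s a c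
         - (of_real c powr (- s)
            + 1 / 2 * gamma_ratio s * (1 - \<i> * cot (of_real pi * s / 2))
              * exp (2 * of_real pi * \<i> * of_real (1 - a) * of_real c)
              * of_real (1 - a) powr (s - 1)))
       \<longlongrightarrow> lerch_zeta_star s 1 0)
       (at (1, 0) within {0<..<1} \<times> {0<..<1})
   \<and> ((\<lambda>(a, c). lerch_zeta_star s a c
         - (of_real c powr (- s)
            + 1 / 2 * gamma_ratio s * (1 + \<i> * cot (of_real pi * s / 2))
              * exp (- 2 * of_real pi * \<i> * of_real a * of_real c)
              * of_real a powr (s - 1)))
       \<longlongrightarrow> lerch_zeta_star s 0 0)
       (at (0, 0) within {0<..<1} \<times> {0<..<1})"
proof -
  let ?S = "{0<..<1} \<times> {0<..<1} :: (real \<times> real) set"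
  have S: "\<forall>\<^sub>F p in at q within ?S. p \<in> ?S" for q
    by (auto simp: eventually_at_filter)
  have lims: "(fst \<longlongrightarrow> of_int l) (at (of_int l, of_int m) within ?S)"
      "(snd \<longlongrightarrow> of_int m) (at (of_int l, of_int m) within ?S)" for l m
    using tendsto_fst[OF tendsto_ident_at[of "(of_int l :: real, of_int m :: real)" ?S]]
      tendsto_snd[OF tendsto_ident_at[of "(of_int l :: real, of_int m :: real)" ?S]] by simp_all
  \<comment> \<open>Signs inside the open square: \<tau> is 1 at a = 1 and -1 at a = 0, while
    \<sigma> is -1 at c = 1 and 1 at c = 0.\<close>
  have ev: "\<forall>\<^sub>F p in at q within ?S. fst p \<noteq> of_int 1 \<and> of_int 1 - fst p = 1 * \<bar>fst p - of_int 1\<bar>"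
      "\<forall>\<^sub>F p in at q within ?S. fst p \<noteq> of_int 0 \<and> of_int 0 - fst p = - 1 * \<bar>fst p - of_int 0\<bar>"
      "\<forall>\<^sub>F p in at q within ?S. snd p \<noteq> of_int 1 \<and> snd p - of_int 1 = - 1 * \<bar>snd p - of_int 1\<bar>"
      "\<forall>\<^sub>F p in at q within ?S. snd p \<noteq> of_int 0 \<and> snd p - of_int 0 = 1 * \<bar>snd p - of_int 0\<bar>" for q
    by (rule eventually_mono[OF S]; auto)+
  note corner = lerch_zeta_star_corner[OF assms lims]
  show ?thesis
    apply (intro conjI)
    subgoal
      by (rule Lim_transform_eventually[OF corner[OF ev(1) ev(3), simplified]])
         (rule eventually_mono[OF S], auto)
    subgoal
      by (rule Lim_transform_eventually[OF corner[OF ev(2) ev(3), simplified]])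
         (rule eventually_mono[OF S], auto)
    subgoal
      by (rule Lim_transform_eventually[OF corner[OF ev(1) ev(4), simplified]])
         (rule eventually_mono[OF S], auto)
    subgoal
      by (rule Lim_transform_eventually[OF corner[OF ev(2) ev(4), simplified]])
         (rule eventually_mono[OF S], auto)
    done
qed

end
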